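(* Let $G$ be a finite simple graph, let $a\ge 4$ be an integer, and let $P_a$ be a path graph on $a$ vertices. Let $H$ be the graph obtained by attaching $P_a$ to $G$ by identifying one of the endpoints of $P_a$ with a fixed vertex of $G$. Let $b$ be a positive integer with $$1\le b\le \left\lfloor \frac{a-1}{2}\right\rfloor ,$$ let $K$ be a field, let $\mathcal{A}=K[x_v : v\in V(H)]$, and let $I_b(H)\subseteq \mathcal{A}$ be the $b$-path ideal of $H$, i.e. the monomial ideal generated by all squarefree monomials $x_{v_1}x_{v_2}\cdots x_{v_{b+1}}$ for which $v_1,v_2,\dots,v_{b+1}$ form a path of length $b$ in $H$. Then the following hold: (i) $I_b(H)$ admits a strongly superficial element; (ii) $I_b(H)$ satisfies the persistence property; (iii) $I_b(H)$ satisfies the strong persistence property.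
   Context: A path of length $b$ in $H$ is a sequence of $b+1$ distinct vertices $v_1,\dots,v_{b+1}$ of $H$ such that $\{v_i,v_{i+1}\}\in E(H)$ for $1\le i\le b$. The graph $H$ is the disjoint union of $G$ and $P_a$ with one endpoint of $P_a$ identified with the chosen vertex of $G$ (so the other $a-1$ vertices of $P_a$ are new vertices). For a monomial ideal $I$ of a polynomial ring $\mathcal{A}$ over a field, $\operatorname{Ass}_{\mathcal{A}}(\mathcal{A}/I)$ denotes the set of associated primes of $\mathcal{A}/I$. - A strongly superficial element of $I$ is an element $m\in I$ such that $(I^{p+1}:_{\mathcal{A}} m)=I^p$ for every integer $p\ge 1$. - $I$ satisfies the persistence property if $\operatorname{Ass}_{\mathcal{A}}(\mathcal{A}/I^k)\subseteq \operatorname{Ass}_{\mathcal{A}}(\mathcal{A}/I^{k+1})$ for all $k\ge 1$. - $I$ satisfies the strong persistence property if $(I^{k+1}:_{\mathcal{A}} I)=I^k$ for all $k\ge 1$. *)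

theory Defs
  imports
    "HOL-Algebra.Ideal_Product"
    "HOL-Algebra.QuotRing"
    "HOL-Algebra.Module"
    "HOL-Library.Poly_Mapping"
    "Graph_Theory.Pair_Digraph"
    "Graph_Theory.Vertex_Walk"
begin

text \<open>A finite simple graph is a \<^locale>\<open>pair_graph\<close>: a finite, symmetric and loop-free set of
  vertex pairs, an edge \<open>{u, v}\<close> being the two pairs \<open>(u, v)\<close> and \<open>(v, u)\<close>. A path of length \<open>b\<close> is
  a \<^const>\<open>vpath\<close>, i.e. a list of distinct vertices with consecutive ones adjacent, whose
  \<^const>\<open>vwalk_length\<close> (the number of edges) is \<open>b\<close>.\<close>

definition path_graph :: "nat \<Rightarrow> nat pair_pre_digraph" where
  "path_graph a = \<lparr> pverts = {1..a},
     parcs = {(i, j). i \<in> {1..a} \<and> j \<in> {1..a} \<and> (j = Suc i \<or> i = Suc j)} \<rparr>"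

text \<open>The vertex \<open>e\<close> of \<open>P\<close> is identified with the vertex \<open>w\<close> of \<open>G\<close> by never using \<open>Inr e\<close>: its role
  is played by \<open>Inl w\<close>.\<close>

definition attach_at ::
  "'v pair_pre_digraph \<Rightarrow> 'v \<Rightarrow> 'u pair_pre_digraph \<Rightarrow> 'u \<Rightarrow> ('v + 'u) pair_pre_digraph" where
  "attach_at G w P e =
     (let h = (\<lambda>u. if u = e then Inl w else Inr u) in
      \<lparr> pverts = Inl ` pverts G \<union> h ` pverts P,
        parcs = map_prod Inl Inl ` parcs G \<union> map_prod h h ` parcs P \<rparr>)"

lemma pair_graph_path_graph: "pair_graph (path_graph a)"
proof -
  have "finite (parcs (path_graph a))"
    by (rule finite_subset[of _ "{1..a} \<times> {1..a}"]) (auto simp: path_graph_def)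
  then show ?thesis
    by unfold_locales (auto simp: path_graph_def symmetric_def arcs_ends_conv sym_def)
qed

lemma pair_graph_attach_at:
  assumes G: "pair_graph G" and P: "pair_graph P" and w: "w \<in> pverts G"
  shows "pair_graph (attach_at G w P e)"
proof -
  interpret G: pair_graph G by (rule G)
  interpret P: pair_graph P by (rule P)
  define h where "h = (\<lambda>u. if u = e then Inl w else Inr u)"
  have inj: "h u \<noteq> h v" if "u \<noteq> v" for u v
    using that by (auto simp: h_def)
  have symG: "(v, u) \<in> parcs G" if "(u, v) \<in> parcs G" for u v
    using G.sym_arcs that by (auto simp: symmetric_def sym_def)
  have symP: "(v, u) \<in> parcs P" if "(u, v) \<in> parcs P" for u v
    using P.sym_arcs that by (auto simp: symmetric_def sym_def)
  have v: "pverts (attach_at G w P e) = Inl ` pverts G \<union> h ` pverts P"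
    and a: "parcs (attach_at G w P e) = map_prod Inl Inl ` parcs G \<union> map_prod h h ` parcs P"
    by (simp_all add: attach_at_def h_def Let_def)
  show ?thesis
  proof
    fix x assume x: "x \<in> parcs (attach_at G w P e)"
    show "fst x \<in> pverts (attach_at G w P e)"
      using x G.arc_fst_in_verts P.arc_fst_in_verts unfolding v a by force
    show "snd x \<in> pverts (attach_at G w P e)"
      using x G.arc_snd_in_verts P.arc_snd_in_verts unfolding v a by force
    show "fst x \<noteq> snd x"
      using x G.pair_no_loops P.pair_no_loops inj unfolding v a by force
  next
    show "finite (pverts (attach_at G w P e))"
      unfolding v using G.pair_finite_verts P.pair_finite_verts by simp
    show "finite (parcs (attach_at G w P e))"
      unfolding a using G.pair_finite_arcs P.pair_finite_arcs by simp
    show "symmetric (with_proj (attach_at G w P e))"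
      unfolding symmetric_def sym_def using symG symP by (auto simp: a)
  qed
qed

text \<open>A polynomial over \<open>'k\<close> is a finitely supported map from exponent vectors \<^typ>\<open>'x \<Rightarrow>\<^sub>0 nat\<close> to
  coefficients. The ring \<open>K[x\<^sub>v : v \<in> X]\<close> consists of those in which only variables from \<open>X\<close>
  occur.\<close>

definition mpoly_ring :: "'x set \<Rightarrow> (('x \<Rightarrow>\<^sub>0 nat) \<Rightarrow>\<^sub>0 'k::field) ring" where
  "mpoly_ring X = \<lparr> carrier = {f. \<forall>m \<in> Poly_Mapping.keys f. Poly_Mapping.keys m \<subseteq> X},
     monoid.mult = (*), one = 1, zero = 0, add = (+) \<rparr>"

lemma cring_mpoly_ring: "cring (mpoly_ring X :: (('x \<Rightarrow>\<^sub>0 nat) \<Rightarrow>\<^sub>0 'k::field) ring)"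
proof -
  let ?R = "mpoly_ring X :: (('x \<Rightarrow>\<^sub>0 nat) \<Rightarrow>\<^sub>0 'k::field) ring"
  have carrier: "f \<in> carrier ?R \<longleftrightarrow> (\<forall>m \<in> Poly_Mapping.keys f. Poly_Mapping.keys m \<subseteq> X)" for f
    by (simp add: mpoly_ring_def)
  have add_closed: "f + g \<in> carrier ?R" if "f \<in> carrier ?R" "g \<in> carrier ?R" for f g
    using that Poly_Mapping.keys_add[of f g] unfolding carrier by blast
  have mult_closed: "f * g \<in> carrier ?R" if f: "f \<in> carrier ?R" and g: "g \<in> carrier ?R" for f g
    unfolding carrier
  proof
    fix k assume "k \<in> Poly_Mapping.keys (f * g)"
    then obtain m n where "m \<in> Poly_Mapping.keys f" "n \<in> Poly_Mapping.keys g" and k: "k = m + n"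
      using Poly_Mapping.keys_mult[of f g] by blast
    then have "Poly_Mapping.keys m \<subseteq> X" "Poly_Mapping.keys n \<subseteq> X"
      using f g unfolding carrier by blast+
    then show "Poly_Mapping.keys k \<subseteq> X"
      using Poly_Mapping.keys_add[of m n] unfolding k by blast
  qed
  have zero_one: "0 \<in> carrier ?R" "1 \<in> carrier ?R"
    by (simp_all add: carrier)
  have ops: "x \<oplus>\<^bsub>?R\<^esub> y = x + y" "x \<otimes>\<^bsub>?R\<^esub> y = x * y" "\<zero>\<^bsub>?R\<^esub> = 0" "\<one>\<^bsub>?R\<^esub> = 1" for x y
    by (simp_all add: mpoly_ring_def)
  show ?thesis
  proof (rule cringI)
    show "abelian_group ?R"
    proof (rule abelian_groupI)
      fix f assume "f \<in> carrier ?R"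
      then have "- f \<in> carrier ?R" by (simp add: carrier)
      then show "\<exists>g \<in> carrier ?R. g \<oplus>\<^bsub>?R\<^esub> f = \<zero>\<^bsub>?R\<^esub>"
        by (intro bexI[of _ "- f"]) (simp_all add: ops)
    qed (simp_all add: ops add_closed zero_one ac_simps)
    show "Group.comm_monoid ?R"
      by (rule comm_monoidI) (simp_all add: ops mult_closed zero_one ac_simps)
  qed (simp add: ops distrib_right)
qed

definition mvar :: "'x \<Rightarrow> ('x \<Rightarrow>\<^sub>0 nat) \<Rightarrow>\<^sub>0 'k::field" where
  "mvar v = Poly_Mapping.single (Poly_Mapping.single v 1) 1"

definition path_ideal :: "nat \<Rightarrow> 'x pair_pre_digraph \<Rightarrow> (('x \<Rightarrow>\<^sub>0 nat) \<Rightarrow>\<^sub>0 'k::field) set" where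
  "path_ideal b H = Idl\<^bsub>mpoly_ring (pverts H)\<^esub>
     {prod_list (map mvar p) | p. vpath p (with_proj H) \<and> vwalk_length p = b}"

text \<open>Powers of an ideal are taken in the multiplicative monoid \<^const>\<open>ideals_set\<close> of all ideals,
  so the zeroth power is the whole ring.\<close>

abbreviation ideal_pow :: "('a, 'b) ring_scheme \<Rightarrow> 'a set \<Rightarrow> nat \<Rightarrow> 'a set" where
  "ideal_pow R I k \<equiv> I [^]\<^bsub>ideals_set R\<^esub> k"

definition ideal_colon :: "('a, 'b) ring_scheme \<Rightarrow> 'a set \<Rightarrow> 'a set \<Rightarrow> 'a set" where
  "ideal_colon R I S = {r \<in> carrier R. \<forall>s \<in> S. r \<otimes>\<^bsub>R\<^esub> s \<in> I}"

definition quot_module :: "('a, 'b) ring_scheme \<Rightarrow> 'a set \<Rightarrow> ('a, 'a set) module" where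
  "quot_module R I =
     ring.extend (R Quot I) (module.fields (\<lambda>r x. (I +>\<^bsub>R\<^esub> r) \<otimes>\<^bsub>R Quot I\<^esub> x))"

lemma module_quot_module:
  assumes "cring R" "ideal I R"
  shows "Module.module R (quot_module R I)"
proof -
  interpret cring R by fact
  interpret ideal I R by fact
  interpret Q: cring "R Quot I" by (rule quotient_is_cring) fact
  have h: "(+>\<^bsub>R\<^esub>) I \<in> ring_hom R (R Quot I)"
    by (rule rcos_ring_hom)
  have fields: "carrier (quot_module R I) = carrier (R Quot I)"
      "add (quot_module R I) = add (R Quot I)"
      "zero (quot_module R I) = zero (R Quot I)"
      "smult (quot_module R I) = (\<lambda>r x. (I +>\<^bsub>R\<^esub> r) \<otimes>\<^bsub>R Quot I\<^esub> x)"
    by (simp_all add: quot_module_def ring.defs module.defs)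
  have cosets: "I +>\<^bsub>R\<^esub> r \<in> carrier (R Quot I)" if "r \<in> carrier R" for r
    by (rule ring_hom_closed[OF h that])
  show ?thesis
  proof (rule Module.moduleI)
    show "cring R" by fact
    show "abelian_group (quot_module R I)"
    proof (rule abelian_groupI, unfold fields)
      show "x \<oplus>\<^bsub>R Quot I\<^esub> y = y \<oplus>\<^bsub>R Quot I\<^esub> x"
        if "x \<in> carrier (R Quot I)" "y \<in> carrier (R Quot I)" for x y
        by (rule Q.a_comm[OF that])
      show "\<exists>y \<in> carrier (R Quot I). y \<oplus>\<^bsub>R Quot I\<^esub> x = \<zero>\<^bsub>R Quot I\<^esub>"
        if "x \<in> carrier (R Quot I)" for x
        using Q.a_inv_closed[OF that] Q.l_neg[OF that] by blast
    qed (simp_all add: Q.a_assoc)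
  qed (simp_all add: fields cosets Q.l_distr Q.r_distr Q.m_assoc Q.l_one
      ring_hom_add[OF h] ring_hom_mult[OF h] ring_hom_one[OF h])
qed

definition annihilator :: "('a, 'c) ring_scheme \<Rightarrow> ('a, 'b, 'd) module_scheme \<Rightarrow> 'b \<Rightarrow> 'a set" where
  "annihilator R M x = {r \<in> carrier R. r \<odot>\<^bsub>M\<^esub> x = \<zero>\<^bsub>M\<^esub>}"

definition Ass :: "('a, 'c) ring_scheme \<Rightarrow> ('a, 'b, 'd) module_scheme \<Rightarrow> 'a set set" where
  "Ass R M = {P. primeideal P R \<and> (\<exists>x \<in> carrier M. P = annihilator R M x)}"

definition strongly_superficial :: "('a, 'b) ring_scheme \<Rightarrow> 'a set \<Rightarrow> 'a \<Rightarrow> bool" where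
  "strongly_superficial R I m \<longleftrightarrow>
     m \<in> I \<and> (\<forall>p \<ge> 1. ideal_colon R (ideal_pow R I (p + 1)) {m} = ideal_pow R I p)"

definition persistence_property :: "('a, 'b) ring_scheme \<Rightarrow> 'a set \<Rightarrow> bool" where
  "persistence_property R I \<longleftrightarrow>
     (\<forall>k \<ge> 1. Ass R (quot_module R (ideal_pow R I k))
       \<subseteq> Ass R (quot_module R (ideal_pow R I (k + 1))))"

definition strong_persistence_property :: "('a, 'b) ring_scheme \<Rightarrow> 'a set \<Rightarrow> bool" where
  "strong_persistence_property R I \<longleftrightarrow>
     (\<forall>k \<ge> 1. ideal_colon R (ideal_pow R I (k + 1)) I = ideal_pow R I k)"

end

theory Submission
  imports Defs
begin

text \<open>Everything follows from a strongly superficial element \<open>m\<close> of the ideal \<open>I\<close>. Multiplication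
  by \<open>m\<close> embeds \<open>R/I\<^sup>k\<close> into \<open>R/I\<^bsup>k+1\<^esup>\<close>, because \<open>(I\<^bsup>k+1\<^esup> : m) = I\<^sup>k\<close>; it therefore
  carries an element of \<open>R/I\<^sup>k\<close> to one with the same annihilator, which gives persistence. And
  \<open>I\<^sup>k \<subseteq> (I\<^bsup>k+1\<^esup> : I) \<subseteq> (I\<^bsup>k+1\<^esup> : m) = I\<^sup>k\<close>, which gives strong persistence. Both arguments
  work in every commutative ring.

  The element \<open>m\<close> is the monomial of the path \<open>y\<^sub>1, \<dots>, y\<^bsub>b+1\<^esub>\<close> that starts at the free end of the
  pendant path. Each path \<open>q\<close> of length \<open>b\<close> meets it in a final segment
  \<open>{y\<^sub>i, \<dots>, y\<^bsub>b+1\<^esub>}\<close>, possibly empty: a path through \<open>y\<^sub>i\<close> that avoids some \<open>y\<^sub>j\<close> with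
  \<open>i < j \<le> b+1\<close> is trapped among \<open>y\<^sub>1, \<dots>, y\<^bsub>j-1\<^esub>\<close>, where there is no room for its \<open>b+1\<close>
  vertices (\<open>vpath_meets_pendant_path\<close>). Final segments form a chain under inclusion.

  This chain property makes \<open>m\<close> strongly superficial (\<open>power_exponents_cancel\<close>). Suppose that
  \<open>u m = h g\<^sub>1 \<cdots> g\<^bsub>p+1\<^esub>\<close> with a monomial \<open>h\<close> and generators \<open>g\<^sub>i\<close>, ordered such that \<open>g\<^sub>1\<close> has the
  largest trace on the support of \<open>m\<close>. A variable of \<open>m\<close> outside \<open>g\<^sub>1\<close> then occurs in no \<open>g\<^sub>i\<close>, so
  it occurs in \<open>h\<close>. Hence \<open>m\<close>, being squarefree, divides \<open>h g\<^sub>1\<close>, and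
  \<open>u = (h g\<^sub>1 / m) g\<^sub>2 \<cdots> g\<^bsub>p+1\<^esub>\<close> has \<open>p\<close> generators as factors. As powers of a monomial ideal
  are spanned by the monomials that they contain (\<open>ideal_pow_monomials\<close>), this computation with
  exponent vectors determines the whole colon ideal.\<close>

section \<open>Strongly superficial elements and associated primes\<close>

lemma (in cring) ideal_pow_ideal:
  assumes "ideal I R"
  shows "ideal (ideal_pow R I k) R"
proof -
  interpret M: comm_monoid "ideals_set R"
    by (rule ideals_set_is_comm_monoid)
  show ?thesis
    using M.nat_pow_closed[of I k] assms by (simp add: ideals_set_def)
qed

lemma (in cring) ideal_pow_Suc_eq:
  "ideal_pow R I (Suc k) = ideal_prod R (ideal_pow R I k) I"
  by (simp add: ideals_set_def)

lemma (in cring) annihilator_quot_module: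
  assumes I: "ideal I R" and x: "x \<in> carrier R"
  shows "annihilator R (quot_module R I) (I +>\<^bsub>R\<^esub> x) = ideal_colon R I {x}"
proof -
  interpret I: ideal I R by fact
  have "(I +> r) \<otimes>\<^bsub>R Quot I\<^esub> (I +> x) = I \<longleftrightarrow> r \<otimes> x \<in> I" if r: "r \<in> carrier R" for r
  proof -
    have "(I +> r) \<otimes>\<^bsub>R Quot I\<^esub> (I +> x) = I +> (r \<otimes> x)"
      using I.rcos_ring_hom r x by (simp add: ring_hom_mult)
    moreover have "I +> (r \<otimes> x) = I \<longleftrightarrow> r \<otimes> x \<in> I"
      using I.rcos_const_imp_mem[OF m_closed[OF r x]] I.a_rcos_const by (rule iffI)
    ultimately show ?thesis by (rule ssubst[of _ _ "\<lambda>y. y = I \<longleftrightarrow> _"])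
  qed
  then show ?thesis
    by (auto simp: annihilator_def ideal_colon_def quot_module_def ring.defs module.defs FactRing_def)
qed

lemma (in cring) carrier_quot_module:
  "carrier (quot_module R I) = (\<lambda>x. I +> x) ` carrier R"
  by (auto simp: quot_module_def ring.defs FactRing_simps)

text \<open>If \<open>P\<close> is the annihilator of the class of \<open>x\<close> modulo \<open>I\<^sup>k\<close>, then it is also the annihilator
  of the class of \<open>x m\<close> modulo \<open>I\<^bsup>k+1\<^esup>\<close>.\<close>

lemma (in cring) strongly_superficial_imp_persistence:
  assumes I: "ideal I R" and m: "strongly_superficial R I m"
  shows "persistence_property R I"
  unfolding persistence_property_def
proof (intro allI impI subsetI)
  fix k :: nat and P
  assume k: "1 \<le> k" and P: "P \<in> Ass R (quot_module R (ideal_pow R I k))"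
  have mI: "m \<in> carrier R"
    using m I ideal.Icarr by (fastforce simp: strongly_superficial_def)
  have colon: "ideal_colon R (ideal_pow R I (k + 1)) {m} = ideal_pow R I k"
    using m k by (simp add: strongly_superficial_def)
  obtain x where x: "x \<in> carrier R" and P_eq: "P = ideal_colon R (ideal_pow R I k) {x}"
    using P annihilator_quot_module[OF ideal_pow_ideal[OF I]]
    by (auto simp: Ass_def carrier_quot_module)
  have "P = ideal_colon R (ideal_pow R I (k + 1)) {x \<otimes> m}"
    unfolding P_eq colon[symmetric] using x mI by (auto simp: ideal_colon_def m_assoc)
  also have "\<dots> = annihilator R (quot_module R (ideal_pow R I (k + 1)))
      (ideal_pow R I (k + 1) +> (x \<otimes> m))"
    using annihilator_quot_module[OF ideal_pow_ideal[OF I, of "k + 1"] m_closed[OF x mI]] by (rule sym)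
  finally show "P \<in> Ass R (quot_module R (ideal_pow R I (k + 1)))"
    using P x mI unfolding Ass_def carrier_quot_module by blast
qed

lemma (in cring) strongly_superficial_imp_strong_persistence:
  assumes I: "ideal I R" and m: "strongly_superficial R I m"
  shows "strong_persistence_property R I"
  unfolding strong_persistence_property_def
proof (intro allI impI equalityI)
  fix k :: nat
  assume k: "1 \<le> k"
  have "ideal_colon R (ideal_pow R I (k + 1)) I \<subseteq> ideal_colon R (ideal_pow R I (k + 1)) {m}"
    using m by (auto simp: strongly_superficial_def ideal_colon_def)
  then show "ideal_colon R (ideal_pow R I (k + 1)) I \<subseteq> ideal_pow R I k"
    using m k by (simp add: strongly_superficial_def)
  show "ideal_pow R I k \<subseteq> ideal_colon R (ideal_pow R I (k + 1)) I"
    using ideal.Icarr[OF ideal_pow_ideal[OF I, of k]]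
    by (auto simp: ideal_colon_def ideals_set_def intro: ideal_prod.prod)
qed

section \<open>Powers of monomial ideals\<close>

definition monomial_span :: "('x \<Rightarrow>\<^sub>0 nat) set \<Rightarrow> (('x \<Rightarrow>\<^sub>0 nat) \<Rightarrow>\<^sub>0 'k::field) set" where
  "monomial_span S = {f. Poly_Mapping.keys f \<subseteq> S}"

text \<open>These are the exponent vectors of the monomials in \<open>K[x\<^sub>v : v \<in> X]\<close> that lie in the \<open>k\<close>-th
  power of the ideal generated by the monomials with exponents in \<open>M\<close>. The list records which
  generators are used, with multiplicity; for \<open>k = 0\<close> all monomials remain, in agreement with the
  zeroth power being the whole ring.\<close>

definition power_exponents :: "'x set \<Rightarrow> ('x \<Rightarrow>\<^sub>0 nat) set \<Rightarrow> nat \<Rightarrow> ('x \<Rightarrow>\<^sub>0 nat) set" where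
  "power_exponents X M k = {h + sum_list gs | h gs.
     Poly_Mapping.keys h \<subseteq> X \<and> set gs \<subseteq> M \<and> length gs = k}"

lemma keys_add_nat:
  "Poly_Mapping.keys (f + g) = Poly_Mapping.keys f \<union> Poly_Mapping.keys (g :: 'x \<Rightarrow>\<^sub>0 nat)"
  by (auto simp: in_keys_iff lookup_add)

lemma keys_sum_list_nat:
  "Poly_Mapping.keys (sum_list gs) = (\<Union>g \<in> set gs. Poly_Mapping.keys (g :: 'x \<Rightarrow>\<^sub>0 nat))"
  by (induction gs) (simp_all add: keys_add_nat)

lemma keys_power_exponents:
  assumes "\<And>g. g \<in> M \<Longrightarrow> Poly_Mapping.keys g \<subseteq> X" and "s \<in> power_exponents X M k"
  shows "Poly_Mapping.keys s \<subseteq> X"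
  using assms by (fastforce simp: power_exponents_def keys_add_nat keys_sum_list_nat)

lemma power_exponents_up:
  assumes "Poly_Mapping.keys h \<subseteq> X" and "s \<in> power_exponents X M k"
  shows "h + s \<in> power_exponents X M k"
proof -
  obtain h' gs where "s = h' + sum_list gs" "Poly_Mapping.keys h' \<subseteq> X" "set gs \<subseteq> M" "length gs = k"
    using assms(2) by (auto simp: power_exponents_def)
  then show ?thesis
    unfolding power_exponents_def using assms(1)
    by (intro CollectI exI[of _ "h + h'"] exI[of _ gs]) (simp add: keys_add_nat add.assoc)
qed

lemma power_exponents_Suc:
  "power_exponents X M (Suc k) = {s + t | s t. s \<in> power_exponents X M k \<and> t \<in> power_exponents X M 1}"
proof (intro equalityI subsetI)
  fix u assume "u \<in> power_exponents X M (Suc k)"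
  then obtain h gs where u: "u = h + sum_list gs" and h: "Poly_Mapping.keys h \<subseteq> X"
    and gs: "set gs \<subseteq> M" "length gs = Suc k"
    by (auto simp: power_exponents_def)
  then obtain g gs' where gs': "gs = g # gs'"
    by (cases gs) auto
  have "h + sum_list gs' \<in> power_exponents X M k"
    using h gs gs' by (auto simp: power_exponents_def)
  moreover have "g \<in> power_exponents X M 1"
    unfolding power_exponents_def using gs gs'
    by (intro CollectI exI[of _ 0] exI[of _ "[g]"]) simp
  moreover have "u = (h + sum_list gs') + g"
    using u gs' by (simp add: ac_simps)
  ultimately show "u \<in> {s + t | s t. s \<in> power_exponents X M k \<and> t \<in> power_exponents X M 1}"
    by blast
next
  fix u assume "u \<in> {s + t | s t. s \<in> power_exponents X M k \<and> t \<in> power_exponents X M 1}"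
  then obtain h gs h' gs' where u: "u = (h + sum_list gs) + (h' + sum_list gs')"
    and "Poly_Mapping.keys h \<subseteq> X" "Poly_Mapping.keys h' \<subseteq> X" "set gs \<subseteq> M" "set gs' \<subseteq> M"
      "length gs = k" "length gs' = 1"
    by (fastforce simp: power_exponents_def)
  then show "u \<in> power_exponents X M (Suc k)"
    unfolding power_exponents_def
    by (intro CollectI exI[of _ "h + h'"] exI[of _ "gs @ gs'"]) (simp add: keys_add_nat ac_simps)
qed

lemma mpoly_ring_ops:
  "carrier (mpoly_ring X) = monomial_span {h. Poly_Mapping.keys h \<subseteq> X}"
  "x \<otimes>\<^bsub>mpoly_ring X\<^esub> y = x * y" "x \<oplus>\<^bsub>mpoly_ring X\<^esub> y = x + y" "\<zero>\<^bsub>mpoly_ring X\<^esub> = 0"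
  by (auto simp: mpoly_ring_def monomial_span_def)

lemma monomial_span_add:
  "f \<in> monomial_span S \<Longrightarrow> g \<in> monomial_span S \<Longrightarrow> f + g \<in> monomial_span S"
  using Poly_Mapping.keys_add[of f g] by (auto simp: monomial_span_def)

lemma monomial_span_mult:
  assumes "f \<in> monomial_span S" and "g \<in> monomial_span T"
    and "\<And>s t. s \<in> S \<Longrightarrow> t \<in> T \<Longrightarrow> s + t \<in> U"
  shows "f * g \<in> monomial_span U"
  using assms Poly_Mapping.keys_mult[of f g] by (fastforce simp: monomial_span_def)

lemma ideal_monomial_span:
  assumes S: "\<And>s. s \<in> S \<Longrightarrow> Poly_Mapping.keys s \<subseteq> X"
    and up: "\<And>h s. Poly_Mapping.keys h \<subseteq> X \<Longrightarrow> s \<in> S \<Longrightarrow> h + s \<in> S"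
  shows "ideal (monomial_span S :: (('x \<Rightarrow>\<^sub>0 nat) \<Rightarrow>\<^sub>0 'k::field) set) (mpoly_ring X)"
proof -
  let ?R = "mpoly_ring X :: (('x \<Rightarrow>\<^sub>0 nat) \<Rightarrow>\<^sub>0 'k::field) ring"
  interpret R: cring ?R by (rule cring_mpoly_ring)
  have carr: "monomial_span S \<subseteq> carrier ?R"
    using S by (auto simp: mpoly_ring_ops monomial_span_def)
  show ?thesis
  proof (rule idealI)
    show "ring ?R" by (rule R.ring_axioms)
    show "subgroup (monomial_span S) (add_monoid ?R)"
    proof (rule R.add.subgroupI)
      show "monomial_span S \<noteq> ({} :: (('x \<Rightarrow>\<^sub>0 nat) \<Rightarrow>\<^sub>0 'k::field) set)"
        by (auto simp: monomial_span_def intro: exI[of _ 0])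
      fix f :: "('x \<Rightarrow>\<^sub>0 nat) \<Rightarrow>\<^sub>0 'k" assume f: "f \<in> monomial_span S"
      then have mf: "- f \<in> monomial_span S" by (simp add: monomial_span_def)
      have "\<ominus>\<^bsub>?R\<^esub> f = - f"
        using f mf carr by (intro R.minus_equality) (auto simp: mpoly_ring_ops)
      then show "\<ominus>\<^bsub>?R\<^esub> f \<in> monomial_span S" using mf by simp
    qed (use carr in \<open>auto simp: mpoly_ring_ops monomial_span_add\<close>)
  qed (auto simp: mpoly_ring_ops intro!: monomial_span_mult
        intro: up, metis add.commute up)
qed

lemma sum_monomials:
  "(\<Sum>m\<in>Poly_Mapping.keys f. Poly_Mapping.single m (Poly_Mapping.lookup f m)) = f"
  by (rule poly_mapping_eqI) (auto simp: lookup_sum lookup_single when_def in_keys_iff)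

lemma ideal_contains_monomials_imp_mem:
  assumes J: "ideal J (mpoly_ring X)"
    and "\<And>m c. m \<in> Poly_Mapping.keys f \<Longrightarrow> Poly_Mapping.single m c \<in> J"
  shows "f \<in> J"
proof -
  have "(\<Sum>m\<in>F. Poly_Mapping.single m (Poly_Mapping.lookup f m)) \<in> J"
    if "finite F" "F \<subseteq> Poly_Mapping.keys f" for F
    using that
  proof (induction F)
    case empty
    then show ?case using additive_subgroup.zero_closed[OF ideal.axioms(1)[OF J]]
      by (simp add: mpoly_ring_ops(4))
  next
    case (insert m F)
    then show ?case using additive_subgroup.a_closed[OF ideal.axioms(1)[OF J]] assms(2)
      by (simp add: mpoly_ring_ops(3))
  qed
  then have "(\<Sum>m\<in>Poly_Mapping.keys f. Poly_Mapping.single m (Poly_Mapping.lookup f m)) \<in> J"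
    by simp
  then show ?thesis by (simp only: sum_monomials)
qed

text \<open>The monomial with exponent \<open>s + t\<close> is the product of those with exponents \<open>s\<close> and \<open>t\<close>, so
  the ideal product contains every term of a polynomial on the right, hence the polynomial
  itself.\<close>

lemma ideal_prod_monomial_span:
  fixes S T X
  defines "I \<equiv> monomial_span S :: (('x \<Rightarrow>\<^sub>0 nat) \<Rightarrow>\<^sub>0 'k::field) set"
    and "J \<equiv> monomial_span T :: (('x \<Rightarrow>\<^sub>0 nat) \<Rightarrow>\<^sub>0 'k::field) set"
  assumes I: "ideal I (mpoly_ring X)" and J: "ideal J (mpoly_ring X)"
  shows "ideal_prod (mpoly_ring X) I J = monomial_span {s + t | s t. s \<in> S \<and> t \<in> T}"
proof (intro equalityI subsetI)
  let ?R = "mpoly_ring X :: (('x \<Rightarrow>\<^sub>0 nat) \<Rightarrow>\<^sub>0 'k::field) ring"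
  interpret R: cring ?R by (rule cring_mpoly_ring)
  { fix f assume "f \<in> ideal_prod ?R I J"
    then show "f \<in> monomial_span {s + t | s t. s \<in> S \<and> t \<in> T}"
    proof induction
      case (prod f g)
      then show ?case
        unfolding I_def J_def mpoly_ring_ops by (rule monomial_span_mult) blast
    qed (simp add: mpoly_ring_ops monomial_span_add) }
  fix f :: "('x \<Rightarrow>\<^sub>0 nat) \<Rightarrow>\<^sub>0 'k"
  assume f: "f \<in> monomial_span {s + t | s t. s \<in> S \<and> t \<in> T}"
  show "f \<in> ideal_prod ?R I J"
  proof (rule ideal_contains_monomials_imp_mem[OF R.ideal_prod_is_ideal[OF I J]])
    fix m and c :: 'k assume "m \<in> Poly_Mapping.keys f"
    then obtain s t where m: "m = s + t" and st: "s \<in> S" "t \<in> T"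
      using f by (auto simp: monomial_span_def)
    have "Poly_Mapping.single s c \<in> I" "Poly_Mapping.single t 1 \<in> J"
      using st by (auto simp: I_def J_def monomial_span_def)
    from ideal_prod.prod[OF this, of ?R] show "Poly_Mapping.single m c \<in> ideal_prod ?R I J"
      by (simp add: mpoly_ring_ops mult_single m)
  qed
qed

lemma ideal_power_exponents:
  assumes "\<And>g. g \<in> M \<Longrightarrow> Poly_Mapping.keys g \<subseteq> X"
  shows "ideal (monomial_span (power_exponents X M k)) (mpoly_ring X)"
proof (rule ideal_monomial_span)
  show "Poly_Mapping.keys s \<subseteq> X" if "s \<in> power_exponents X M k" for s
    by (rule keys_power_exponents[OF assms that])
qed (rule power_exponents_up)

lemma genideal_monomials:
  assumes M: "\<And>g. g \<in> M \<Longrightarrow> Poly_Mapping.keys g \<subseteq> X"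
  shows "Idl\<^bsub>mpoly_ring X\<^esub> ((\<lambda>g. Poly_Mapping.single g (1 :: 'k::field)) ` M)
    = monomial_span (power_exponents X M 1)" (is "Idl\<^bsub>?R\<^esub> ?E = _")
proof
  interpret R: cring ?R by (rule cring_mpoly_ring)
  have E: "?E \<subseteq> carrier ?R"
  proof (rule image_subsetI)
    show "Poly_Mapping.single g 1 \<in> carrier ?R" if "g \<in> M" for g
      using M[OF that] by (simp add: mpoly_ring_ops monomial_span_def)
  qed
  have "g \<in> power_exponents X M 1" if "g \<in> M" for g
    unfolding power_exponents_def using that
    by (intro CollectI exI[of _ 0] exI[of _ "[g]"]) simp
  then show "Idl\<^bsub>?R\<^esub> ?E \<subseteq> monomial_span (power_exponents X M 1)"
    by (intro R.genideal_minimal ideal_power_exponents M) (auto simp: monomial_span_def)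
  have idl: "ideal (Idl\<^bsub>?R\<^esub> ?E) ?R"
    by (rule R.genideal_ideal[OF E])
  show "monomial_span (power_exponents X M 1) \<subseteq> Idl\<^bsub>?R\<^esub> ?E"
  proof
    fix f :: "('a \<Rightarrow>\<^sub>0 nat) \<Rightarrow>\<^sub>0 'k"
    assume f: "f \<in> monomial_span (power_exponents X M 1)"
    show "f \<in> Idl\<^bsub>?R\<^esub> ?E"
    proof (rule ideal_contains_monomials_imp_mem[OF idl])
      fix m and c :: 'k assume "m \<in> Poly_Mapping.keys f"
      then obtain h g where m: "m = h + g" and h: "Poly_Mapping.keys h \<subseteq> X" and g: "g \<in> M"
        using f by (auto simp: monomial_span_def power_exponents_def length_Suc_conv)
      have "Poly_Mapping.single h c \<otimes>\<^bsub>?R\<^esub> Poly_Mapping.single g 1 \<in> Idl\<^bsub>?R\<^esub> ?E"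
      proof (rule ideal.I_l_closed[OF idl])
        show "Poly_Mapping.single g 1 \<in> Idl\<^bsub>?R\<^esub> ?E"
          using g R.genideal_self[OF E] by blast
        show "Poly_Mapping.single h c \<in> carrier ?R"
          using h by (auto simp: mpoly_ring_ops monomial_span_def)
      qed
      then show "Poly_Mapping.single m c \<in> Idl\<^bsub>?R\<^esub> ?E"
        by (simp add: mpoly_ring_ops mult_single m)
    qed
  qed
qed

lemma ideal_pow_monomials:
  fixes X M
  defines "I \<equiv> monomial_span (power_exponents X M 1) :: (('x \<Rightarrow>\<^sub>0 nat) \<Rightarrow>\<^sub>0 'k::field) set"
  assumes M: "\<And>g. g \<in> M \<Longrightarrow> Poly_Mapping.keys g \<subseteq> X"
  shows "ideal_pow (mpoly_ring X) I k = monomial_span (power_exponents X M k)"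
proof (induction k)
  case 0
  have "power_exponents X M 0 = {h. Poly_Mapping.keys h \<subseteq> X}"
    by (auto simp: power_exponents_def)
  then show ?case by (simp add: ideals_set_def mpoly_ring_ops)
next
  case (Suc k)
  interpret R: cring "mpoly_ring X :: (('x \<Rightarrow>\<^sub>0 nat) \<Rightarrow>\<^sub>0 'k::field) ring" by (rule cring_mpoly_ring)
  have "ideal_pow (mpoly_ring X) I (Suc k) = ideal_prod (mpoly_ring X) (ideal_pow (mpoly_ring X) I k) I"
    by (rule R.ideal_pow_Suc_eq)
  also have "\<dots> = ideal_prod (mpoly_ring X) (monomial_span (power_exponents X M k)) I"
    by (subst Suc) (rule refl)
  also have "\<dots> = monomial_span (power_exponents X M (Suc k))"
    unfolding power_exponents_Suc I_def
    by (rule ideal_prod_monomial_span; rule ideal_power_exponents[OF M])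
  finally show ?case .
qed

section \<open>A chain condition for strong superficiality\<close>

text \<open>Multiplicatively: if \<open>u t\<close> is divisible by \<open>p + 1\<close> generators, then dividing by \<open>t\<close> costs
  only one of them. The one to give up is a generator whose trace on the support of \<open>t\<close> is largest.
  The variables of \<open>t\<close> that it misses are missed by all the other generators as well, so they must
  come from the cofactor \<open>h\<close>.\<close>

lemma power_exponents_cancel:
  fixes t u :: "'x \<Rightarrow>\<^sub>0 nat"
  assumes sqfree: "\<And>v. Poly_Mapping.lookup t v \<le> 1"
    and chain: "\<And>g g'. g \<in> M \<Longrightarrow> g' \<in> M \<Longrightarrow>
      Poly_Mapping.keys g \<inter> Poly_Mapping.keys t \<subseteq> Poly_Mapping.keys g' \<or>
      Poly_Mapping.keys g' \<inter> Poly_Mapping.keys t \<subseteq> Poly_Mapping.keys g"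
    and M: "\<And>g. g \<in> M \<Longrightarrow> Poly_Mapping.keys g \<subseteq> X"
    and ut: "u + t \<in> power_exponents X M (Suc p)"
  shows "u \<in> power_exponents X M p"
proof -
  obtain h gs where eq: "u + t = h + sum_list gs" and h: "Poly_Mapping.keys h \<subseteq> X"
    and gs: "set gs \<subseteq> M" "length gs = Suc p"
    using ut by (auto simp: power_exponents_def)
  have "\<exists>g \<in> set gs. \<forall>g' \<in> set gs. Poly_Mapping.keys g' \<inter> Poly_Mapping.keys t \<subseteq> Poly_Mapping.keys g"
  proof -
    let ?T = "\<lambda>g. Poly_Mapping.keys g \<inter> Poly_Mapping.keys t"
    have "gs \<noteq> []" using gs by auto
    then have "Max ((\<lambda>g. card (?T g)) ` set gs) \<in> (\<lambda>g. card (?T g)) ` set gs"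
      by (intro Max_in) auto
    then obtain g where g: "g \<in> set gs" and "card (?T g) = Max ((\<lambda>g. card (?T g)) ` set gs)"
      by auto
    then have max: "card (?T g') \<le> card (?T g)" if "g' \<in> set gs" for g'
      using that by simp
    have "?T g' \<subseteq> ?T g" if "g' \<in> set gs" for g'
    proof (cases "?T g \<subseteq> ?T g'")
      case True
      then have "?T g = ?T g'"
        using max[OF that] by (intro card_seteq) auto
      then show ?thesis by simp
    next
      case False
      then show ?thesis using chain[of g g'] g that gs by blast
    qed
    then show ?thesis using g by blast
  qed
  then obtain g where g: "g \<in> set gs"
    and max: "\<And>g'. g' \<in> set gs \<Longrightarrow> Poly_Mapping.keys g' \<inter> Poly_Mapping.keys t \<subseteq> Poly_Mapping.keys g"
    by blast
  have le: "Poly_Mapping.lookup t v \<le> Poly_Mapping.lookup (h + g) v" for v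
  proof (cases "v \<in> Poly_Mapping.keys t \<and> v \<notin> Poly_Mapping.keys g")
    case True
    then have "v \<notin> Poly_Mapping.keys (sum_list gs)"
      using max by (auto simp: keys_sum_list_nat)
    then have "Poly_Mapping.lookup (u + t) v = Poly_Mapping.lookup h v"
      unfolding eq by (simp add: lookup_add in_keys_iff)
    then show ?thesis by (simp add: lookup_add)
  next
    case False
    then show ?thesis using sqfree[of v] by (auto simp: lookup_add in_keys_iff)
  qed
  \<comment> \<open>Subtraction of exponents truncates at \<open>0\<close>; by \<open>le\<close> nothing is lost here.\<close>
  define r where "r = h + g - t"
  have r: "h + g = r + t"
    using le by (intro poly_mapping_eqI) (simp add: r_def lookup_add lookup_minus)
  have "sum_list gs = g + sum_list (remove1 g gs)"
    using sum_list_map_remove1[OF g, of id] by simp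
  then have "u + t = (h + g) + sum_list (remove1 g gs)"
    unfolding eq by (simp only: add.assoc)
  also have "\<dots> = (r + sum_list (remove1 g gs)) + t"
    unfolding r by (simp only: ac_simps)
  finally have "u = r + sum_list (remove1 g gs)" by simp
  moreover have "Poly_Mapping.keys r \<subseteq> X"
  proof -
    have "Poly_Mapping.keys (h + g) \<subseteq> X"
      using h M[of g] g gs(1) by (auto simp: keys_add_nat)
    then show ?thesis unfolding r by (simp add: keys_add_nat)
  qed
  moreover have "set (remove1 g gs) \<subseteq> M"
    using gs set_remove1_subset[of g gs] by blast
  ultimately show ?thesis
    unfolding power_exponents_def using g gs
    by (intro CollectI exI[of _ r] exI[of _ "remove1 g gs"]) (simp add: length_remove1)
qed

lemma keys_times_monomial:
  fixes f :: "('x \<Rightarrow>\<^sub>0 nat) \<Rightarrow>\<^sub>0 'k::field"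
  shows "Poly_Mapping.keys (f * Poly_Mapping.single t 1) = (\<lambda>u. u + t) ` Poly_Mapping.keys f"
proof -
  have "Poly_Mapping.lookup (f * Poly_Mapping.single t 1) (u + t) = Poly_Mapping.lookup f u" for u
  proof -
    have "f * Poly_Mapping.single t 1
        = (\<Sum>m\<in>Poly_Mapping.keys f. Poly_Mapping.single (m + t) (Poly_Mapping.lookup f m))"
      by (subst sum_monomials[of f, symmetric], subst sum_distrib_right) (simp add: mult_single)
    then show ?thesis
      by (simp add: lookup_sum lookup_single when_def in_keys_iff)
  qed
  then show ?thesis
    using Poly_Mapping.keys_mult[of f "Poly_Mapping.single t 1"]
    by (fastforce simp: in_keys_iff)
qed

text \<open>Multiplying by the monomial with exponent \<open>t\<close> shifts all exponents by \<open>t\<close>, so the colon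
  ideal can be read off from exponent vectors, where cancellation of \<open>t\<close> is available.\<close>

lemma strongly_superficial_if_chain:
  fixes X M
  defines "I \<equiv> monomial_span (power_exponents X M 1) :: (('x \<Rightarrow>\<^sub>0 nat) \<Rightarrow>\<^sub>0 'k::field) set"
  assumes t: "t \<in> M"
    and sqfree: "\<And>v. Poly_Mapping.lookup t v \<le> 1"
    and chain: "\<And>g g'. g \<in> M \<Longrightarrow> g' \<in> M \<Longrightarrow>
      Poly_Mapping.keys g \<inter> Poly_Mapping.keys t \<subseteq> Poly_Mapping.keys g' \<or>
      Poly_Mapping.keys g' \<inter> Poly_Mapping.keys t \<subseteq> Poly_Mapping.keys g"
    and M: "\<And>g. g \<in> M \<Longrightarrow> Poly_Mapping.keys g \<subseteq> X"
  shows "strongly_superficial (mpoly_ring X) I (Poly_Mapping.single t 1)"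
proof -
  have pow: "ideal_pow (mpoly_ring X) I k = monomial_span (power_exponents X M k)" for k
    unfolding I_def by (rule ideal_pow_monomials[OF M])
  have t1: "t \<in> power_exponents X M 1"
    unfolding power_exponents_def using t
    by (intro CollectI exI[of _ 0] exI[of _ "[t]"]) simp
  have shift: "u + t \<in> power_exponents X M (p + 1) \<longleftrightarrow> u \<in> power_exponents X M p" for u p
  proof
    assume "u + t \<in> power_exponents X M (p + 1)"
    then have "u + t \<in> power_exponents X M (Suc p)" by simp
    with sqfree chain M show "u \<in> power_exponents X M p"
      by (rule power_exponents_cancel)
  next
    assume "u \<in> power_exponents X M p"
    then show "u + t \<in> power_exponents X M (p + 1)"
      using t1 power_exponents_Suc[of X M p] by auto
  qed
  have "ideal_colon (mpoly_ring X) (ideal_pow (mpoly_ring X) I (p + 1)) {Poly_Mapping.single t 1}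
      = ideal_pow (mpoly_ring X) I p" for p
  proof -
    have "Poly_Mapping.keys s \<subseteq> X" if "s \<in> power_exponents X M p" for s
      by (rule keys_power_exponents[OF M that])
    then have "power_exponents X M p \<subseteq> {h. Poly_Mapping.keys h \<subseteq> X}" by blast
    then show ?thesis
      by (simp only: pow ideal_colon_def mpoly_ring_ops monomial_span_def keys_times_monomial
          mem_Collect_eq ball_simps image_subset_iff shift) blast
  qed
  then show ?thesis
    using t1 by (simp add: strongly_superficial_def I_def monomial_span_def)
qed

section \<open>Paths running into a pendant path\<close>

definition path_exponent :: "'x list \<Rightarrow> 'x \<Rightarrow>\<^sub>0 nat" where
  "path_exponent p = sum_list (map (\<lambda>v. Poly_Mapping.single v 1) p)"

lemma prod_list_mvar:
  "prod_list (map mvar p) = Poly_Mapping.single (path_exponent p) (1 :: 'k::field)"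
  by (induction p) (simp_all add: path_exponent_def mvar_def mult_single)

lemma lookup_path_exponent:
  "distinct p \<Longrightarrow> Poly_Mapping.lookup (path_exponent p) v = (if v \<in> set p then 1 else 0)"
  by (induction p) (auto simp: path_exponent_def lookup_add lookup_single when_def)

lemma keys_path_exponent: "Poly_Mapping.keys (path_exponent p) = set p"
  by (auto simp: path_exponent_def keys_sum_list_nat)

text \<open>A walk cannot leave \<open>S\<close> if no edge between two of its vertices crosses the boundary
  of \<open>S\<close>. Only such edges matter, so \<open>S\<close> may be cut off from the rest of the graph by a vertex that
  the walk avoids.\<close>

lemma vwalk_connected:
  assumes q: "vwalk q D"
    and closed: "\<And>u v. (u, v) \<in> arcs_ends D \<Longrightarrow> u \<in> set q \<Longrightarrow> v \<in> set q \<Longrightarrow> u \<in> S \<longleftrightarrow> v \<in> S"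
    and "x \<in> set q" "x \<in> S"
  shows "set q \<subseteq> S"
proof -
  have "(\<And>u v. (u, v) \<in> set (vwalk_arcs q) \<Longrightarrow> u \<in> S \<longleftrightarrow> v \<in> S) \<Longrightarrow> set q \<subseteq> S \<or> set q \<inter> S = {}"
    by (induction q rule: vwalk_arcs.induct) auto
  moreover have "u \<in> S \<longleftrightarrow> v \<in> S" if "(u, v) \<in> set (vwalk_arcs q)" for u v
  proof -
    have "u \<in> set q" "v \<in> set q"
      using that by (auto elim: in_set_vwalk_arcsE)
    moreover have "(u, v) \<in> arcs_ends D"
      using that q by (auto simp: vwalk_def)
    ultimately show ?thesis by (intro closed)
  qed
  ultimately show ?thesis using assms(3,4) by blast
qed

text \<open>In the pendant path, \<open>y j\<close> separates \<open>y 1, \<dots>, y (j - 1)\<close> from the rest of the graph. If the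
  path \<open>q\<close>, which passes through \<open>y i\<close>, avoided \<open>y j\<close>, then its
  \<open>b + 1\<close> vertices would have to fit among these \<open>j - 1 \<le> b\<close> ones.\<close>

lemma vpath_meets_pendant_path:
  fixes y :: "nat \<Rightarrow> 'x"
  assumes H: "pair_graph H"
    and nbr: "\<And>i z. 1 \<le> i \<Longrightarrow> i < a \<Longrightarrow> (y i, z) \<in> parcs H \<Longrightarrow>
      \<exists>j \<in> {1..a}. z = y j \<and> (j = Suc i \<or> i = Suc j)"
    and q: "vpath q (with_proj H)" "length q = b + 1"
    and ij: "1 \<le> i" "i \<le> j" "j \<le> b + 1" "j \<le> a"
    and yi: "y i \<in> set q"
  shows "y j \<in> set q"
proof (rule ccontr)
  assume yj: "y j \<notin> set q"
  let ?S = "y ` {1..<j}"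
  interpret pair_graph H by fact
  have step: "v \<in> ?S" if uv: "(u, v) \<in> parcs H" and u: "u \<in> ?S" and v: "v \<in> set q" for u v
  proof -
    obtain k where k: "u = y k" "1 \<le> k" "k < j" using u by auto
    have "k < a" using k ij by simp
    then obtain l where l: "l \<in> {1..a}" "v = y l" "l = Suc k \<or> k = Suc l"
      using nbr[OF k(2)] uv unfolding k(1) by blast
    then have "l \<noteq> j" using yj v by auto
    then show ?thesis using l k by auto
  qed
  have "set q \<subseteq> ?S"
  proof (rule vwalk_connected)
    show "vwalk q (with_proj H)" using q by (simp add: vpath_def)
    show "u \<in> ?S \<longleftrightarrow> v \<in> ?S" if "(u, v) \<in> arcs_ends (with_proj H)" "u \<in> set q" "v \<in> set q" for u v
    proof -
      have "(u, v) \<in> parcs H" "(v, u) \<in> parcs H"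
        using that(1) arcs_symmetric by auto
      then show ?thesis using step that(2,3) by blast
    qed
    have "i \<noteq> j" using yi yj by auto
    then show "y i \<in> ?S" using ij by auto
  qed (rule yi)
  then have "card (set q) \<le> card {1..<j}"
    by (meson card_image_le card_mono finite_atLeastLessThan finite_imageI order_trans)
  moreover have "card (set q) = b + 1"
    using q by (simp add: vpath_def distinct_card)
  ultimately show False using ij by simp
qed

text \<open>The pendant path is numbered from its free end: vertex \<open>1\<close> is the leaf and vertex \<open>a\<close> is the
  attaching vertex \<open>w\<close> of the graph. When the endpoint \<open>1\<close> of the path graph is the one that is
  glued, its own numbering has to be reversed.\<close>

definition pendant_vertex :: "'v \<Rightarrow> nat \<Rightarrow> nat \<Rightarrow> nat \<Rightarrow> 'v + nat" where
  "pendant_vertex w a e j =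
     (if j = a then Inl w else Inr (if e = a then j else a + 1 - j))"

text \<open>A pendant vertex other than the attaching one has no neighbours outside the pendant
  path.\<close>

lemma arcs_attach_path_graph:
  assumes e: "e \<in> {1, a}" and i: "1 \<le> i" "i < a"
  shows "(pendant_vertex w a e i, z) \<in> parcs (attach_at G w (path_graph a) e) \<longleftrightarrow>
    (\<exists>j \<in> {1..a}. z = pendant_vertex w a e j \<and> (j = Suc i \<or> i = Suc j))"
proof -
  \<comment> \<open>The renumbering \<open>s\<close> is an involution of the path graph that puts the glued end at \<open>s a = e\<close>.\<close>
  define s where "s = (\<lambda>j. if e = a then j else a + 1 - j)"
  define h where "h = (\<lambda>u. if u = e then Inl w else Inr u)"
  have s: "s (s j) = j" "s j \<in> {1..a}" if "j \<in> {1..a}" for j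
    using that by (auto simp: s_def)
  have y: "pendant_vertex w a e j = h (s j)" if "j \<in> {1..a}" for j
    using that e by (auto simp: pendant_vertex_def h_def s_def)
  have yi: "pendant_vertex w a e i = Inr (s i)" and sie: "s i \<noteq> e"
    using i e by (auto simp: pendant_vertex_def s_def)
  have "(pendant_vertex w a e i, z) \<in> parcs (attach_at G w (path_graph a) e)
      \<longleftrightarrow> (\<exists>v. (s i, v) \<in> parcs (path_graph a) \<and> z = h v)"
    using sie unfolding yi attach_at_def h_def[symmetric] Let_def
    by (force simp: h_def split: if_splits)
  also have "\<dots> \<longleftrightarrow> (\<exists>v \<in> {1..a}. (v = Suc (s i) \<or> s i = Suc v) \<and> z = h v)"
    using s(2)[of i] i by (auto simp: path_graph_def)
  also have "\<dots> \<longleftrightarrow> (\<exists>j \<in> {1..a}. (s j = Suc (s i) \<or> s i = Suc (s j)) \<and> z = h (s j))"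
    using s by metis
  also have "\<dots> \<longleftrightarrow> (\<exists>j \<in> {1..a}. z = pendant_vertex w a e j \<and> (j = Suc i \<or> i = Suc j))"
  proof (rule bex_cong[OF refl])
    fix j assume j: "j \<in> {1..a}"
    have "(s j = Suc (s i) \<or> s i = Suc (s j)) \<longleftrightarrow> (j = Suc i \<or> i = Suc j)"
      using j i by (auto simp: s_def)
    then show "((s j = Suc (s i) \<or> s i = Suc (s j)) \<and> z = h (s j)) \<longleftrightarrow>
        (z = pendant_vertex w a e j \<and> (j = Suc i \<or> i = Suc j))"
      using y[OF j] by auto
  qed
  finally show ?thesis .
qed

lemma inj_on_pendant_vertex: "inj_on (pendant_vertex w a e) {1..a}"
  by (rule inj_onI) (auto simp: pendant_vertex_def split: if_splits)

lemma pendant_vertex_in_verts: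
  assumes "e \<in> {1, a}" "w \<in> pverts G" "j \<in> {1..a}"
  shows "pendant_vertex w a e j \<in> pverts (attach_at G w (path_graph a) e)"
  using assms by (auto simp: pendant_vertex_def attach_at_def path_graph_def Let_def image_iff)

lemma vwalk_map_upt:
  assumes "\<And>i. m \<le> i \<Longrightarrow> i < n \<Longrightarrow> y i \<in> verts D"
    and "\<And>i. m \<le> i \<Longrightarrow> Suc i < n \<Longrightarrow> (y i, y (Suc i)) \<in> arcs_ends D"
    and "m < n"
  shows "vwalk (map y [m..<n]) D"
  using assms
proof (induction "n - m" arbitrary: m)
  case (Suc k)
  show ?case
  proof (cases "Suc m = n")
    case True
    then show ?thesis using Suc.prems by (auto simp: vwalk_def upt_rec[of m n])
  next
    case False
    then have "vwalk (map y [Suc m..<n]) D"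
      using Suc by (intro Suc.hyps) auto
    then show ?thesis
      using Suc.prems False vwalk_consI[of "map y [Suc m..<n]" D "y m"]
      by (simp add: upt_conv_Cons hd_map)
  qed
qed simp

theorem theorem2p1:
  fixes G :: "'v pair_pre_digraph" and w :: 'v
    and a b e :: nat
    and H :: "('v + nat) pair_pre_digraph"
    and A :: "((('v + nat) \<Rightarrow>\<^sub>0 nat) \<Rightarrow>\<^sub>0 'k::field) ring"
    and I :: "((('v + nat) \<Rightarrow>\<^sub>0 nat) \<Rightarrow>\<^sub>0 'k) set"
  assumes "pair_graph G" and "w \<in> pverts G"
    and "a \<ge> 4"
    and "e \<in> {1, a}"
    and "H = attach_at G w (path_graph a) e"
    and "1 \<le> b" and "b \<le> (a - 1) div 2"
    and "A = mpoly_ring (pverts H)"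
    and "I = path_ideal b H"
  shows "(\<exists>m. strongly_superficial A I m) \<and>
         persistence_property A I \<and>
         strong_persistence_property A I"
proof -
  let ?y = "pendant_vertex w a e" and ?D = "with_proj H"
  define paths where "paths = {p. vpath p ?D \<and> vwalk_length p = b}"
  define M where "M = path_exponent ` paths"
  \<comment> \<open>The path of length \<open>b\<close> at the free end; its monomial is the strongly superficial element.\<close>
  define p where "p = map ?y [1..<b + 2]"
  have b: "1 \<le> b" "b + 1 \<le> a"
    using assms(3,6,7) by auto
  have H: "pair_graph H"
    unfolding assms(5) by (rule pair_graph_attach_at[OF assms(1) pair_graph_path_graph assms(2)])
  note arcs = arcs_attach_path_graph[OF assms(4), of _ w _ G, folded assms(5)]
  have keysM: "Poly_Mapping.keys g \<subseteq> pverts H" if "g \<in> M" for g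
    using that by (auto simp: M_def paths_def vpath_def vwalk_def keys_path_exponent)
  have I_eq: "I = monomial_span (power_exponents (pverts H) M 1)"
    using genideal_monomials[of M "pverts H", OF keysM, where 'k = 'k]
    by (simp add: assms(9) path_ideal_def M_def paths_def image_image prod_list_mvar
        setcompr_eq_image)
  have I: "ideal I A"
    unfolding I_eq assms(8) by (rule ideal_power_exponents[OF keysM])
  have "vpath p ?D"
  proof (rule vpathI)
    show "vwalk p ?D"
      unfolding p_def using b assms(2,4)
      by (intro vwalk_map_upt) (auto simp: assms(5) pendant_vertex_in_verts arcs_attach_path_graph)
    have "inj_on ?y {1..<b + 2}"
      by (rule inj_on_subset[OF inj_on_pendant_vertex]) (use b in auto)
    then show "distinct p"
      unfolding p_def distinct_map set_upt by (intro conjI distinct_upt)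
  qed
  then have p: "p \<in> paths" "distinct p"
    by (auto simp: paths_def p_def vpath_def)
  have up: "?y j \<in> set q" if "q \<in> paths" "1 \<le> i" "i \<le> j" "j \<le> b + 1" "?y i \<in> set q" for q i j
    using that b arcs by (intro vpath_meets_pendant_path[OF H, of a ?y q b i j]) (auto simp: paths_def)
  have set_p: "set p = ?y ` {1..b + 1}"
    unfolding p_def set_map set_upt by (rule arg_cong[of _ _ "image ?y"]) auto
  \<comment> \<open>By \<open>up\<close>, traces on \<open>p\<close> are final segments, so of two of them one contains the other.\<close>
  have chain: "set q \<inter> set p \<subseteq> set q' \<or> set q' \<inter> set p \<subseteq> set q"
    if "q \<in> paths" "q' \<in> paths" for q q'
  proof (rule ccontr)
    assume "\<not> ?thesis"
    then obtain i j where "i \<in> {1..b + 1}" "j \<in> {1..b + 1}"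
      "?y i \<in> set q" "?y i \<notin> set q'" "?y j \<in> set q'" "?y j \<notin> set q"
      unfolding set_p by blast
    then show False
      using up[OF that(1), of i j] up[OF that(2), of j i] by (cases "i \<le> j") auto
  qed
  have m: "strongly_superficial A I (Poly_Mapping.single (path_exponent p) 1)"
    unfolding I_eq assms(8)
  proof (rule strongly_superficial_if_chain[OF _ _ _ keysM])
    show "path_exponent p \<in> M" using p by (simp add: M_def)
    show "Poly_Mapping.lookup (path_exponent p) v \<le> 1" for v
      using p by (simp add: lookup_path_exponent)
    show "Poly_Mapping.keys g \<inter> Poly_Mapping.keys (path_exponent p) \<subseteq> Poly_Mapping.keys g' \<or>
        Poly_Mapping.keys g' \<inter> Poly_Mapping.keys (path_exponent p) \<subseteq> Poly_Mapping.keys g"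
      if "g \<in> M" "g' \<in> M" for g g'
    proof -
      obtain q q' where "q \<in> paths" "q' \<in> paths" and g: "g = path_exponent q" "g' = path_exponent q'"
        using \<open>g \<in> M\<close> \<open>g' \<in> M\<close> by (auto simp: M_def)
      then show ?thesis
        unfolding g keys_path_exponent by (intro chain)
    qed
  qed
  interpret A: cring A
    unfolding assms(8) by (rule cring_mpoly_ring)
  show ?thesis
    using m A.strongly_superficial_imp_persistence[OF I m]
      A.strongly_superficial_imp_strong_persistence[OF I m] by (intro conjI exI)
qed

end
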